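(* Let $\mathcal{W}$ be an intersecting collection of $k$-words on $[n]$, $n\geq 2k$. Then $$|\mathcal{W}|\leq n^k-n^{k-1}.$$ Furthermore, $|\mathcal{W}|$ attains this maximal value when and only when $\mathcal{W}$ is trivial.
   Context: Here $n,k$ are positive integers and $[n]=\{1,2,\ldots,n\}$. A $k$-word on $[n]$ is an ordered $k$-tuple $w_1\ldots w_k$ each of whose entries is an element of $[n]$ (repetitions allowed). The intersection $W\cap V$ of two words is the multiset of elements that appear somewhere (in any position) in both $W$ and $V$, multiplicities included; so $|W\cap V|\geq 1$ means that some element of $[n]$ appears in both words. A collection $\mathcal{W}$ of $k$-words is intersecting if $|W\cap V|\geq 1$ for all $W,V\in\mathcal{W}$. A collection is trivial if it consists of all $k$-words on $[n]$ that contain $x$ in at least one position, for some fixed element $x\in[n]$.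
   Formalization: The bound n^k − n^{k−1} is replaced, in the inequality and the equality case, by n^k − (n−1)^k, the size of a trivial collection; the printed value is wrong (n=4, k=2: a trivial collection has 7 words, not 12). *)

theory Defs
  imports Complex_Main "HOL-Library.Multiset"
begin

definition words :: "nat \<Rightarrow> nat \<Rightarrow> nat list set" where
  "words n k = {w. length w = k \<and> set w \<subseteq> {1..n}}"

definition word_inter :: "nat list \<Rightarrow> nat list \<Rightarrow> nat multiset" where
  "word_inter w v = mset w \<inter># mset v"

definition intersecting :: "nat list set \<Rightarrow> bool" where
  "intersecting \<W> \<longleftrightarrow> (\<forall>w\<in>\<W>. \<forall>v\<in>\<W>. size (word_inter w v) \<ge> 1)"

definition trivial_collection :: "nat \<Rightarrow> nat \<Rightarrow> nat list set \<Rightarrow> bool" where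
  "trivial_collection n k \<W> \<longleftrightarrow> (\<exists>x\<in>{1..n}. \<W> = {w \<in> words n k. x \<in> set w})"

text \<open>The two facts below explain the bound \<open>n ^ k - (n - 1) ^ k\<close> of the theorem: it is the size of
  a trivial collection, whereas \<open>n ^ k - n ^ (k - 1)\<close> is a strictly larger number (unless
  \<open>n = 2\<close> and \<open>k = 1\<close>), which no trivial collection attains.\<close>

lemma card_trivial_collection:
  assumes "trivial_collection n k \<W>"
  shows "card \<W> = n ^ k - (n - 1) ^ k"
proof -
  obtain x where x: "x \<in> {1..n}" and W: "\<W> = {w \<in> words n k. x \<in> set w}"
    using assms unfolding trivial_collection_def by blast
  let ?A = "{w. set w \<subseteq> {1..n} \<and> length w = k}"
  let ?B = "{w. set w \<subseteq> {1..n} - {x} \<and> length w = k}"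
  have "\<W> = ?A - ?B"
    unfolding W words_def by auto
  moreover have "finite ?B" "?B \<subseteq> ?A"
    by (auto intro: finite_lists_length_eq)
  ultimately have "card \<W> = card ?A - card ?B"
    by (simp add: card_Diff_subset)
  then show ?thesis
    using x by (simp add: card_lists_length_eq)
qed

lemma trivial_size_less:
  fixes n k :: nat
  assumes "k \<ge> 1" "n \<ge> 2 * k" "n \<ge> 3"
  shows "n ^ k - (n - 1) ^ k < n ^ k - n ^ (k - 1)"
proof -
  obtain j where j: "k = Suc j"
    using assms(1) by (cases k) auto
  have "1 / 2 \<le> 1 + real k * (- 1 / real n)"
    using assms by (simp add: field_simps)
  also have "\<dots> \<le> (1 + (- 1 / real n)) ^ k"
    using assms by (intro Bernoulli_inequality) (simp add: field_simps)
  also have "1 + (- 1 / real n) = real (n - 1) / real n"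
    using assms by (simp add: field_simps of_nat_diff)
  finally have "real n ^ k \<le> 2 * real (n - 1) ^ k"
    using assms by (simp add: power_divide field_simps)
  then have "real (n ^ k) \<le> real (2 * (n - 1) ^ k)"
    unfolding of_nat_mult of_nat_power of_nat_numeral .
  then have "n ^ k \<le> 2 * (n - 1) ^ k"
    by (simp only: of_nat_le_iff)
  moreover have "3 * n ^ j \<le> n ^ k"
    using assms(3) by (simp add: j)
  moreover have "n ^ j > 0"
    using assms(3) by simp
  ultimately have "n ^ j < (n - 1) ^ k"
    by linarith
  moreover have "n ^ j < n ^ k"
    using \<open>3 * n ^ j \<le> n ^ k\<close> \<open>n ^ j > 0\<close> by linarith
  moreover have "k - 1 = j"
    by (simp add: j)
  ultimately show ?thesis
    by (simp only: diff_less_mono2)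
qed

end

theory Submission
  imports Defs "HOL-Combinatorics.Permutations"
begin

text \<open>The number of words with a given support depends only on the size \<open>j \<le> k\<close> of the support, and
  the supports of the words in \<open>\<W>\<close> intersect pairwise. Since \<open>2 * j \<le> n\<close>, the
  Erdos-Ko-Rado theorem bounds the number of supports of size \<open>j\<close> by the number attained by a
  trivial collection. Equality is needed already for \<open>j = 1\<close>, where it yields a support \<open>{x}\<close>
  that every other support must meet; hence uniqueness holds even for \<open>n = 2 * k\<close>, where the
  extremal families of \<open>k\<close>-sets are not unique.\<close>

section \<open>Permutations carrying one subset to another\<close>

lemma permutes_image_exists:
  assumes "finite X" "S \<subseteq> X" "T \<subseteq> X" "card S = card T"
  obtains q where "q permutes X" "q ` S = T"
proof -
  have fin: "finite S" "finite T"
    using assms by (auto intro: finite_subset)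
  obtain f where f: "bij_betw f S T"
    using finite_same_card_bij[OF fin assms(4)] by blast
  have "card (X - S) = card (X - T)"
    using assms fin by (simp add: card_Diff_subset)
  then obtain g where g: "bij_betw g (X - S) (X - T)"
    using finite_same_card_bij assms(1) by (metis finite_Diff)
  \<comment> \<open>The two bijections are glued; \<open>q\<close> fixes all points outside
    \<open>X\<close>, as \<open>permutes\<close> demands.\<close>
  define q where "q = (\<lambda>x. if x \<in> S then f x else if x \<in> X then g x else x)"
  have qS: "bij_betw q S T"
    using f by (rule bij_betw_cong[THEN iffD1, rotated]) (simp add: q_def)
  have qD: "bij_betw q (X - S) (X - T)"
    using g by (rule bij_betw_cong[THEN iffD1, rotated]) (simp add: q_def)
  have "bij_betw q (S \<union> (X - S)) (T \<union> (X - T))"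
    using qS qD by (rule bij_betw_combine) auto
  moreover have "S \<union> (X - S) = X" "T \<union> (X - T) = X"
    using assms by auto
  ultimately have "bij_betw q X X"
    by simp
  then have "q permutes X"
    by (rule bij_imp_permutes) (use assms in \<open>auto simp: q_def\<close>)
  moreover have "q ` S = T"
    using qS by (simp add: bij_betw_def)
  ultimately show ?thesis
    using that by blast
qed

text \<open>Sort all permutations of \<open>X\<close> by the image of \<open>A\<close>. Composing
  with a permutation that takes \<open>S\<close> to \<open>T\<close> matches the class of
  \<open>S\<close> with that of \<open>T\<close>, so all classes are equally large. The product form
  avoids division.\<close>

lemma card_permutes_image:
  assumes "finite X" "A \<subseteq> X" "S \<subseteq> X" "card A = card S"
  shows "(card X choose card S) * card {p. p permutes X \<and> p ` A = S} = fact (card X)"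
proof -
  let ?N = "\<lambda>T. {p. p permutes X \<and> p ` A = T}"
  let ?C = "{T. T \<subseteq> X \<and> card T = card S}"
  have finP: "finite {p. p permutes X}"
    using assms(1) by (rule finite_permutations)
  have const: "card (?N T) = card (?N S)" if T: "T \<in> ?C" for T
  proof -
    obtain q where q: "q permutes X" "q ` S = T"
      using permutes_image_exists[OF assms(1,3), of T] T by auto
    have "bij_betw (\<lambda>p. q \<circ> p) (?N S) (?N T)"
    proof (rule bij_betw_byWitness[where f' = "\<lambda>p. inv q \<circ> p"])
      show "\<forall>p\<in>?N S. inv q \<circ> (q \<circ> p) = p"
        using permutes_inv_o(2)[OF q(1)] by (simp add: o_assoc)
      show "\<forall>p\<in>?N T. q \<circ> (inv q \<circ> p) = p"
        using permutes_inv_o(1)[OF q(1)] by (simp add: o_assoc)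
      show "(\<lambda>p. q \<circ> p) ` ?N S \<subseteq> ?N T"
        using q by (auto simp: permutes_compose image_comp[symmetric])
      have "inv q ` T = S"
        using q permutes_inj[OF q(1)] by (auto simp: image_inv_f_f)
      then show "(\<lambda>p. inv q \<circ> p) ` ?N T \<subseteq> ?N S"
        using permutes_inv[OF q(1)] by (auto simp: permutes_compose image_comp[symmetric])
    qed
    then show ?thesis
      by (simp add: bij_betw_same_card)
  qed
  have "{p. p permutes X} = (\<Union>T\<in>?C. ?N T)"
  proof -
    have "p ` A \<in> ?C" if "p permutes X" for p
      using that assms permutes_image[OF that] permutes_inj[OF that]
      by (auto simp: card_image inj_on_subset)
    then show ?thesis
      by blast
  qed
  moreover have "card (\<Union>T\<in>?C. ?N T) = (\<Sum>T\<in>?C. card (?N T))"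
    using assms(1) finP by (intro card_UN_disjoint) (auto intro: finite_subset[OF _ finP])
  ultimately have "fact (card X) = (\<Sum>T\<in>?C. card (?N T))"
    using card_permutations[OF refl assms(1)] by simp
  also have "\<dots> = card ?C * card (?N S)"
    using const by simp
  finally show ?thesis
    using assms(1) by (simp add: n_subsets)
qed

section \<open>Cyclic arcs and the Erdos-Ko-Rado theorem\<close>

definition arc :: "int \<Rightarrow> int \<Rightarrow> int \<Rightarrow> int set" where
  "arc n j i = (\<lambda>t. (i + t) mod n) ` {0..<j}"

lemma arc_subset:
  assumes "0 < n"
  shows "arc n j i \<subseteq> {0..<n}"
  using assms by (auto simp: arc_def)

lemma card_arc:
  assumes "j \<le> n"
  shows "card (arc n j i) = nat j"
proof -
  have "inj_on (\<lambda>t. (i + t) mod n) {0..<j}"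
  proof (rule inj_onI)
    fix s t assume st: "s \<in> {0..<j}" "t \<in> {0..<j}" "(i + s) mod n = (i + t) mod n"
    then have "n dvd s - t"
      by (simp add: mod_eq_dvd_iff)
    moreover have "\<bar>s - t\<bar> < n"
      using st assms by auto
    ultimately show "s = t"
      using dvd_imp_le_int[of "s - t" n] by auto
  qed
  then show ?thesis
    by (simp add: arc_def card_image)
qed

text \<open>Turns intersection into a condition on starting points: a common point reached after
  \<open>t\<close> and \<open>t'\<close> steps gives \<open>s = t' - t\<close>.\<close>

lemma arc_inter_dvd:
  assumes "arc n j i \<inter> arc n j i' \<noteq> {}"
  obtains s where "\<bar>s\<bar> < j" "n dvd i - i' - s"
proof -
  obtain t t' where t: "t \<in> {0..<j}" "t' \<in> {0..<j}" "(i + t) mod n = (i' + t') mod n"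
    using assms unfolding arc_def by (blast elim: equalityE)
  then have "n dvd i - i' - (t' - t)"
    by (simp add: mod_eq_dvd_iff algebra_simps)
  then show ?thesis
    using t that[of "t' - t"] by auto
qed

text \<open>Relative to a member \<open>a\<close>, every other member starts at distance less than \<open>j\<close> on
  either side; the arcs starting at \<open>a + d\<close> and \<open>a + d - j\<close> are disjoint, so
  at most one member comes from each such pair.\<close>

lemma card_intersecting_arcs:
  fixes n j :: int
  assumes "0 < j" "2 * j \<le> n" and I: "I \<subseteq> {0..<n}"
    and inter: "\<And>i i'. i \<in> I \<Longrightarrow> i' \<in> I \<Longrightarrow> arc n j i \<inter> arc n j i' \<noteq> {}"
  shows "card I \<le> nat j"
proof (cases "I = {}")
  case False
  then obtain a where a: "a \<in> I"
    by blast
  define d where "d i = (i - a) mod n" for i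
  \<comment> \<open>The fold by \<open>n - j\<close> identifies exactly the two starts of a disjoint
    pair, so \<open>e\<close> is injective on \<open>I\<close> once \<open>clash\<close> is
    known.\<close>
  define e where "e i = (if d i < j then d i else d i - (n - j))" for i
  have n0: "0 < n"
    using assms by linarith
  have d_range: "0 \<le> d i" "d i < n" for i
    using n0 by (simp_all add: d_def)
  have d_dvd: "n dvd i - a - d i" for i
    by (simp add: d_def)
  have near: "d i < j \<or> n - j < d i" if i: "i \<in> I" for i
  proof -
    obtain s where s: "\<bar>s\<bar> < j" "n dvd i - a - s"
      using arc_inter_dvd inter[OF i a] by blast
    have "n dvd d i - s"
      using dvd_diff[OF s(2) d_dvd[of i]] by simp
    then obtain c where c: "d i - s = n * c" ..
    \<comment> \<open>A multiple of \<open>n\<close> strictly between \<open>-n\<close> and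
      \<open>2 * n\<close> is 0 or \<open>n\<close>, so \<open>d i\<close> is \<open>s\<close> or
      \<open>n + s\<close>.\<close>
    have "n * (-1) < n * c" "n * c < n * 2"
      using c s d_range[of i] assms by linarith+
    then have "-1 < c" "c < 2"
      using n0 by (simp_all only: mult_less_cancel_left_pos)
    then have "c = 0 \<or> c = 1"
      by linarith
    then show ?thesis
      using c s by auto
  qed
  have clash: False if i: "i \<in> I" "i' \<in> I" and dd: "d i' = d i + (n - j)" for i i'
  proof -
    obtain s where s: "\<bar>s\<bar> < j" "n dvd i' - i - s"
      using arc_inter_dvd inter[OF i(2,1)] by blast
    have "n dvd (i' - a - d i') - (i - a - d i) - (i' - i - s)"
      by (rule dvd_diff[OF dvd_diff[OF d_dvd d_dvd] s(2)])
    also have "(i' - a - d i') - (i - a - d i) - (i' - i - s) = j + s - n"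
      using dd by simp
    finally have "n dvd j + s"
      by (metis dvd_diffD dvd_refl dvd_diff_commute dvd_add_right_iff diff_add_cancel)
    \<comment> \<open>Here \<open>0 < j + s < 2 * j \<le> n\<close>, which excludes a multiple of
      \<open>n\<close>.\<close>
    then show False
      using zdvd_imp_le[of n "j + s"] s assms by linarith
  qed
  have inj: "inj_on e I"
  proof (rule inj_onI)
    fix i i' assume i: "i \<in> I" "i' \<in> I" "e i = e i'"
    have "d i = d i'"
      using i clash[of i i'] clash[of i' i] by (auto simp: e_def split: if_splits)
    then have "n dvd i - i'"
      using dvd_diff[OF d_dvd[of i] d_dvd[of i']] by simp
    moreover have "\<bar>i - i'\<bar> < n"
      using subsetD[OF I i(1)] subsetD[OF I i(2)] by auto
    ultimately show "i = i'"
      using dvd_imp_le_int[of "i - i'" n] by auto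
  qed
  have "e ` I \<subseteq> {0..<j}"
  proof
    fix y assume "y \<in> e ` I"
    then obtain i where i: "i \<in> I" "y = e i"
      by blast
    then show "y \<in> {0..<j}"
      using near[OF i(1)] d_range[of i] by (auto simp: e_def)
  qed
  then have "card I \<le> card {0..<j}"
    using inj by (intro card_inj_on_le) auto
  then show ?thesis
    by simp
qed simp

text \<open>Katona's double counting of the pairs of a permutation \<open>p\<close> and an arc that \<open>p\<close> maps
  into the family.\<close>

lemma Erdos_Ko_Rado:
  assumes X: "finite X" and j: "0 < j" "2 * j \<le> card X"
    and F: "\<And>S. S \<in> F \<Longrightarrow> S \<subseteq> X \<and> card S = j"
    and inter: "\<And>S T. S \<in> F \<Longrightarrow> T \<in> F \<Longrightarrow> S \<inter> T \<noteq> {}"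
  shows "card F \<le> (card X - 1) choose (j - 1)"
proof (cases "F = {}")
  case False
  define n where "n = card X"
  have n: "0 < n" "2 * j \<le> n"
    using j by (auto simp: n_def)
  have finF: "finite F"
    using X F by (intro finite_subset[of F "Pow X"]) auto
  \<comment> \<open>\<open>h\<close> fixes one cyclic arrangement of \<open>X\<close>; the
    permutations \<open>p\<close> then produce the others.\<close>
  obtain h :: "int \<Rightarrow> 'a" where h: "bij_betw h {0..<int n} X"
    using finite_same_card_bij[of "{0..<int n}" X] X by (auto simp: n_def)
  define A where "A i = h ` arc (int n) (int j) i" for i
  have A_sub: "A i \<subseteq> X" for i
    using arc_subset[of "int n" "int j" i] h n by (auto simp: A_def bij_betw_def)
  have A_card: "card (A i) = j" for i
    using card_arc[of "int j" "int n" i] arc_subset[of "int n" "int j" i] h n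
    by (auto simp: A_def bij_betw_def card_image inj_on_subset)
  define P where "P = {p. p permutes X}"
  have finP: "finite P"
    using X by (simp add: P_def finite_permutations)
  have cardP: "card P = fact n"
    using X by (simp add: P_def n_def card_permutations)
  \<comment> \<open>Since \<open>p\<close> and \<open>h\<close> are injective, the arcs mapped into
    \<open>F\<close> meet pairwise, and the bound for arcs applies.\<close>
  have few: "card {i \<in> {0..<int n}. p ` A i \<in> F} \<le> j" if p: "p \<in> P" for p
  proof -
    have "card {i \<in> {0..<int n}. p ` A i \<in> F} \<le> nat (int j)"
    proof (rule card_intersecting_arcs)
      fix i i' assume "i \<in> {i \<in> {0..<int n}. p ` A i \<in> F}" "i' \<in> {i \<in> {0..<int n}. p ` A i \<in> F}"
      then have "p ` A i \<inter> p ` A i' \<noteq> {}"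
        using inter by blast
      moreover have "p ` A i \<inter> p ` A i' = p ` h ` (arc (int n) (int j) i \<inter> arc (int n) (int j) i')"
      proof -
        have "inj p"
          using p by (auto simp: P_def permutes_inj)
        then have "p ` A i \<inter> p ` A i' = p ` (A i \<inter> A i')"
          by (simp add: image_Int)
        also have "A i \<inter> A i' = h ` (arc (int n) (int j) i \<inter> arc (int n) (int j) i')"
          unfolding A_def using h n arc_subset
          by (intro inj_on_image_Int[symmetric, of h "{0..<int n}"]) (auto simp: bij_betw_def)
        finally show ?thesis .
      qed
      ultimately show "arc (int n) (int j) i \<inter> arc (int n) (int j) i' \<noteq> {}"
        by auto
    qed (use j n in auto)
    then show ?thesis
      by simp
  qed
  \<comment> \<open>For a fixed arc, every member of \<open>F\<close> is its image under equally
    many permutations.\<close>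
  have each: "(n choose j) * card {p \<in> P. p ` A i \<in> F} = card F * fact n" for i
  proof -
    have "{p \<in> P. p ` A i \<in> F} = (\<Union>S\<in>F. {p. p permutes X \<and> p ` A i = S})"
      by (auto simp: P_def)
    moreover have "card (\<Union>S\<in>F. {p. p permutes X \<and> p ` A i = S})
        = (\<Sum>S\<in>F. card {p. p permutes X \<and> p ` A i = S})"
      using finF finP by (intro card_UN_disjoint) (auto simp: P_def intro: finite_subset[OF _ finP])
    ultimately have "(n choose j) * card {p \<in> P. p ` A i \<in> F}
        = (\<Sum>S\<in>F. (n choose j) * card {p. p permutes X \<and> p ` A i = S})"
      by (simp add: sum_distrib_left)
    also have "\<dots> = (\<Sum>S\<in>F. fact n)"
      using F A_card by (intro sum.cong refl) (metis card_permutes_image[OF X A_sub] n_def)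
    finally show ?thesis
      by simp
  qed
  have swap: "(\<Sum>i\<in>{0..<int n}. card {p \<in> P. p ` A i \<in> F})
      = (\<Sum>p\<in>P. card {i \<in> {0..<int n}. p ` A i \<in> F})"
    using sum.swap_restrict[OF finite_atLeastLessThan_int finP, of "\<lambda>_ _. 1::nat"]
    by (simp only: card_eq_sum)
  have "n * (card F * fact n) = (\<Sum>i\<in>{0..<int n}. (n choose j) * card {p \<in> P. p ` A i \<in> F})"
    by (simp add: each)
  also have "\<dots> = (n choose j) * (\<Sum>p\<in>P. card {i \<in> {0..<int n}. p ` A i \<in> F})"
    by (simp add: swap flip: sum_distrib_left)
  also have "\<dots> \<le> (n choose j) * (\<Sum>p\<in>P. j)"
    using few by (intro mult_left_mono sum_mono) auto
  also have "\<dots> = (j * (n choose j)) * fact n"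
    by (simp add: cardP)
  \<comment> \<open>The absorption identity makes \<open>n * fact n\<close> a common factor of both
    sides.\<close>
  also have "j * (n choose j) = n * ((n - 1) choose (j - 1))"
    using times_binomial_minus1_eq[OF j(1)] by simp
  finally have "(n * fact n) * card F \<le> (n * fact n) * ((n - 1) choose (j - 1))"
    by (simp add: mult_ac)
  then show ?thesis
    using n by (simp add: n_def)
qed simp

section \<open>Sets through a point, and words counted by support\<close>

text \<open>Removing \<open>x\<close> leaves a set of size \<open>j - 1\<close>. So the sets through
  a point attain the Erdos-Ko-Rado bound.\<close>

lemma card_subsets_containing:
  assumes "finite X" "x \<in> X" "0 < j"
  shows "card {S. S \<subseteq> X \<and> card S = j \<and> x \<in> S} = (card X - 1) choose (j - 1)"
proof -
  let ?B = "{S. S \<subseteq> X - {x} \<and> card S = j - 1}"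
  have "bij_betw (insert x) ?B {S. S \<subseteq> X \<and> card S = j \<and> x \<in> S}"
  proof (rule bij_betw_byWitness[where f' = "\<lambda>S. S - {x}"])
    have "card (insert x S) = j" if "S \<subseteq> X - {x}" "card S = j - 1" for S
    proof -
      have "finite S" "x \<notin> S"
        using that assms by (auto intro: finite_subset)
      then show ?thesis
        using that assms by simp
    qed
    then show "insert x ` ?B \<subseteq> {S. S \<subseteq> X \<and> card S = j \<and> x \<in> S}"
      using assms by auto
  qed (use assms in auto)
  then have "card {S. S \<subseteq> X \<and> card S = j \<and> x \<in> S} = card ?B"
    by (simp add: bij_betw_same_card)
  then show ?thesis
    using assms by (simp add: n_subsets)
qed

text \<open>These are the surjections from the \<open>k\<close> positions onto \<open>S\<close>.
  Demanding equality of supports keeps the classes of distinct \<open>S\<close> disjoint.\<close>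

definition words_on :: "'a set \<Rightarrow> nat \<Rightarrow> 'a list set" where
  "words_on S k = {w. length w = k \<and> set w = S}"

lemma finite_words_on: "finite S \<Longrightarrow> finite (words_on S k)"
  by (rule finite_subset[OF _ finite_lists_length_eq[of S k]]) (auto simp: words_on_def)

lemma card_words_on_cong:
  assumes "finite S" "finite T" "card S = card T"
  shows "card (words_on S k) = card (words_on T k)"
proof -
  obtain f where f: "bij_betw f S T"
    using finite_same_card_bij[OF assms] by blast
  have "bij_betw (map f) (words_on S k) (words_on T k)"
    by (rule bij_betw_byWitness[where f' = "map (inv_into S f)"])
      (use f in \<open>auto simp: words_on_def bij_betw_def f_inv_into_f intro!: map_idI\<close>)
  then show ?thesis
    by (rule bij_betw_same_card)
qed

text \<open>With \<open>{1..j}\<close> standing for any support of size \<open>j\<close>, the family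
  enters only through its number of members of each size.\<close>

lemma card_words_by_support:
  assumes "finite F" and F: "\<And>S. S \<in> F \<Longrightarrow> finite S \<and> 1 \<le> card S \<and> card S \<le> k"
  shows "card {w. length w = k \<and> set w \<in> F}
    = (\<Sum>j=1..k. card {S \<in> F. card S = j} * card (words_on {1..j} k))"
proof -
  have "{w. length w = k \<and> set w \<in> F} = (\<Union>S\<in>F. words_on S k)"
    by (auto simp: words_on_def)
  moreover have "card (\<Union>S\<in>F. words_on S k) = (\<Sum>S\<in>F. card (words_on S k))"
    using assms by (intro card_UN_disjoint) (simp_all add: finite_words_on, auto simp: words_on_def)
  ultimately have "card {w. length w = k \<and> set w \<in> F} = (\<Sum>S\<in>F. card (words_on S k))"
    by simp
  also have "\<dots> = (\<Sum>S\<in>F. card (words_on {1..card S} k))"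
    using F by (intro sum.cong card_words_on_cong) auto
  also have "\<dots> = (\<Sum>j=1..k. \<Sum>S\<in>{S \<in> F. card S = j}. card (words_on {1..card S} k))"
    using assms by (intro sum.group[symmetric]) auto
  also have "\<dots> = (\<Sum>j=1..k. card {S \<in> F. card S = j} * card (words_on {1..j} k))"
    by simp
  finally show ?thesis .
qed

section \<open>Bound and equality case for words\<close>

theorem theorem3p3:
  fixes n k :: nat and \<W> :: "nat list set"
  assumes "n \<ge> 1" and "k \<ge> 1" and "n \<ge> 2 * k"
    and "\<W> \<subseteq> words n k" and "intersecting \<W>"
  shows "card \<W> \<le> n ^ k - (n - 1) ^ k \<and>
    (card \<W> = n ^ k - (n - 1) ^ k \<longleftrightarrow> trivial_collection n k \<W>)"
proof -
  let ?b = "n ^ k - (n - 1) ^ k"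
  let ?c = "\<lambda>j::nat. card (words_on {1..j} k)"
  let ?T = "\<lambda>x. {w \<in> words n k. x \<in> set w}"
  let ?G = "{S. S \<subseteq> {1..n} \<and> 1 \<in> S \<and> card S \<le> k}"
  define F where "F = set ` \<W>"
  let ?m = "\<lambda>j. card {S \<in> F. card S = j}"
  have fin_words: "finite (words n k)"
    unfolding words_def by (rule finite_subset[OF _ finite_lists_length_eq[of "{1..n}" k]]) auto
  then have finW: "finite \<W>"
    using assms(4) by (rule rev_finite_subset)
  have F: "finite S \<and> 1 \<le> card S \<and> card S \<le> k \<and> S \<subseteq> {1..n}" if "S \<in> F" for S
  proof -
    obtain w where w: "S = set w" "length w = k" "set w \<subseteq> {1..n}"
      using \<open>S \<in> F\<close> assms(4) by (auto simp: F_def words_def)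
    moreover have "w \<noteq> []"
      using w assms(2) by auto
    ultimately show ?thesis
      using card_length[of w] by (simp add: Suc_le_eq card_gt_0_iff)
  qed
  have meet: "S \<inter> T \<noteq> {}" if ST: "S \<in> F" "T \<in> F" for S T
  proof -
    obtain v w where vw: "v \<in> \<W>" "w \<in> \<W>" "S = set v" "T = set w"
      using ST by (auto simp: F_def)
    then have "mset v \<inter># mset w \<noteq> {#}"
      using assms(5) by (fastforce simp: intersecting_def word_inter_def)
    then have "set_mset (mset v \<inter># mset w) \<noteq> {}"
      by (simp only: set_mset_eq_empty_iff not_False_eq_True)
    then show ?thesis
      using vw by simp
  qed
  have EKR: "?m j \<le> (n - 1) choose (j - 1)" if j: "j \<in> {1..k}" for j
    using Erdos_Ko_Rado[of "{1..n}" j "{S \<in> F. card S = j}"] F meet j assms(3) by simp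
  \<comment> \<open>The bound is counted as the trivial collection at 1, whose supports form
    \<open>?G\<close>. This gives it the same weights \<open>?c j\<close> as the sum for
    \<open>F\<close>, so the two compare term by term.\<close>
  have bound: "?b = (\<Sum>j=1..k. ((n - 1) choose (j - 1)) * ?c j)"
  proof -
    have G: "finite S \<and> 1 \<le> card S \<and> card S \<le> k" if "S \<in> ?G" for S
      using that by (auto simp: Suc_le_eq card_gt_0_iff intro: finite_subset)
    have "trivial_collection n k (?T 1)"
      using assms(1) by (auto simp: trivial_collection_def)
    then have "?b = card (?T 1)"
      by (simp add: card_trivial_collection)
    also have "?T 1 = {w. length w = k \<and> set w \<in> ?G}"
      using card_length by (auto simp: words_def)
    also have "card \<dots> = (\<Sum>j=1..k. card {S \<in> ?G. card S = j} * ?c j)"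
      using G by (intro card_words_by_support) auto
    also have "\<dots> = (\<Sum>j=1..k. ((n - 1) choose (j - 1)) * ?c j)"
    proof (rule sum.cong[OF refl])
      fix j assume j: "j \<in> {1..k}"
      have "{S \<in> ?G. card S = j} = {S. S \<subseteq> {1..n} \<and> card S = j \<and> 1 \<in> S}"
        using j by auto
      then show "card {S \<in> ?G. card S = j} * ?c j = ((n - 1) choose (j - 1)) * ?c j"
        using card_subsets_containing[of "{1..n}" 1 j] j assms(1) by simp
    qed
    finally show ?thesis .
  qed
  \<comment> \<open>\<open>\<W>\<close> may omit some words whose support lies in \<open>F\<close>;
    adding them all only enlarges it.\<close>
  have "card \<W> \<le> card {w. length w = k \<and> set w \<in> F}"
  proof (rule card_mono)
    show "\<W> \<subseteq> {w. length w = k \<and> set w \<in> F}"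
      using assms(4) by (auto simp: F_def words_def)
    show "finite {w. length w = k \<and> set w \<in> F}"
      using F by (intro finite_subset[OF _ fin_words]) (auto simp: words_def)
  qed
  also have "\<dots> = (\<Sum>j=1..k. ?m j * ?c j)"
    using F finW by (intro card_words_by_support) (auto simp: F_def)
  finally have le: "card \<W> \<le> (\<Sum>j=1..k. ?m j * ?c j)" .
  also have "\<dots> \<le> ?b"
    unfolding bound using EKR by (intro sum_mono mult_right_mono) auto
  finally have upper: "card \<W> \<le> ?b" .
  have "trivial_collection n k \<W>" if eq: "card \<W> = ?b"
  proof -
    \<comment> \<open>At \<open>j = 1\<close> the binomial is 1 and constant words make
      \<open>?c 1\<close> positive. Without a singleton in \<open>F\<close> this term falls short,
      and no other term can compensate.\<close>
    have "?m 1 \<noteq> 0"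
    proof
      assume m: "?m 1 = 0"
      have "replicate k 1 \<in> words_on {1..1::nat} k"
        using assms(2) by (simp add: words_on_def)
      then have "0 < ?c 1"
        using finite_words_on[OF finite_atLeastAtMost, of 1 "1::nat" k]
        by (subst card_gt_0_iff) blast
      then have "?m 1 * ?c 1 < ((n - 1) choose (1 - 1)) * ?c 1"
        by (simp only: m) simp
      moreover have "1 \<in> {1..k}"
        using assms(2) by simp
      moreover have "\<forall>j\<in>{1..k}. ?m j * ?c j \<le> ((n - 1) choose (j - 1)) * ?c j"
        using EKR by (intro ballI mult_right_mono) auto
      ultimately have "(\<Sum>j=1..k. ?m j * ?c j) < (\<Sum>j=1..k. ((n - 1) choose (j - 1)) * ?c j)"
        by (intro sum_strict_mono_ex1) blast+
      then show False
        using le eq bound by linarith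
    qed
    then obtain S where S: "S \<in> F" "card S = 1"
      by (metis (mono_tags, lifting) card_eq_0_iff ex_in_conv mem_Collect_eq)
    then obtain x where x: "{x} \<in> F"
      by (auto simp: card_1_singleton_iff)
    then have xn: "x \<in> {1..n}"
      using F by blast
    \<comment> \<open>Every support meets \<open>{x}\<close>, hence contains \<open>x\<close>; equal
      cardinalities then turn the inclusion into equality.\<close>
    have "\<W> \<subseteq> ?T x"
    proof
      fix w assume w: "w \<in> \<W>"
      then have "set w \<in> F"
        by (simp add: F_def)
      then show "w \<in> ?T x"
        using meet[OF x] w assms(4) by auto
    qed
    moreover have "card (?T x) = ?b"
      using xn by (intro card_trivial_collection) (auto simp: trivial_collection_def)
    ultimately have "\<W> = ?T x"
      using fin_words eq by (intro card_subset_eq) auto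
    then show ?thesis
      using xn by (auto simp: trivial_collection_def)
  qed
  then show ?thesis
    using upper card_trivial_collection by blast
qed

end
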